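(* Let $(V,E)$ be a finite oriented hypergraph with $e_{in}\ne\varnothing\ne e_{out}$ and $\#(e_{in}\cup e_{out})\ge2$ for all $e\in E$. For $p\ge1$ and every $k$, the min-max eigenvalues of the $p$-Laplacians satisfy $$\frac{2^{p-1}}{p^p}\big(\lambda_k(\Delta_1)\big)^p\le\lambda_k(\Delta_p)\le2^{p-1}\lambda_k(\Delta_1),$$ and in particular $$2^{p-1}\frac{h^p}{p^p}\le\lambda_2(\Delta_p)\le2^{p-1}h,$$ where $h$ is the hyperedge expansion of $(V,E)$.
   Context: An oriented hypergraph $(V,E)$ has a vertex set $V$ and hyperedges $e\in E$, each with a set of inputs $e_{in}\subset V$ and a set of outputs $e_{out}\subset V$ (not necessarily disjoint); $i\in e$ means $i\in e_{in}\cup e_{out}$. The degree is $\deg(i)=\#\{e\in E:i\in e\}$ (assumed positive), and $\mathrm{vol}(A)=\sum_{i\in A}\deg(i)$ for $A\subset V$. The $k$-th min-max eigenvalue of the $p$-Laplacian $\Delta_p$ is $$\lambda_k(\Delta_p)=\inf_{Y}\ \sup_{f\in Y}\frac{\sum_{e\in E}\big|\max_{u\in e_{in}}f(u)-\min_{v\in e_{out}}f(v)\big|^p}{\sum_{v\in V}\deg(v)|f(v)|^p},$$ where the infimum is over $Y\subset\mathbb{R}^V\setminus\{0\}$ with $\mathrm{genus}(Y)\ge k$, and $\mathrm{genus}(Y)$ is the Krasnoselskii genus: the least $m$ such that there is a continuous map $\zeta:Y\to\mathbb{S}^{m-1}$ with $\zeta(x)=-\zeta(-x)$ (and $+\infty$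 if none exists). The hyperedge expansion is $h=\min_{A\subset V,\ A\ne\varnothing,V}\frac{\#(\partial A)}{\min\{\mathrm{vol}(A),\mathrm{vol}(V\setminus A)\}}$, where $\partial A=\{e\in E: (e_{in}\cap A\ne\varnothing\text{ and }e_{out}\setminus A\neq\varnothing)\ \text{or}\ e_{out}\subset A\subset V\setminus e_{in}\}$. *)

theory Defs
  imports "HOL-Analysis.Analysis"
begin

text \<open>
  The vertex set is the (finite, nonempty) type \<open>'v\<close>, so \<open>\<real>\<^sup>V\<close> is \<open>real ^ 'v\<close>. Hyperedges are indexed by
  a set of labels, so distinct hyperedges may have the same inputs and outputs.
\<close>

record ('v, 'e) oriented_hypergraph =
  hyperedges :: "'e set"
  inp :: "'e \<Rightarrow> 'v set"
  outp :: "'e \<Rightarrow> 'v set"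

definition deg :: "('v, 'e) oriented_hypergraph \<Rightarrow> 'v \<Rightarrow> nat" where
  "deg H v = card {e \<in> hyperedges H. v \<in> inp H e \<union> outp H e}"

definition vol :: "('v, 'e) oriented_hypergraph \<Rightarrow> 'v set \<Rightarrow> nat" where
  "vol H A = (\<Sum>v\<in>A. deg H v)"

definition boundary :: "('v, 'e) oriented_hypergraph \<Rightarrow> 'v set \<Rightarrow> 'e set" where
  "boundary H A = {e \<in> hyperedges H.
     (inp H e \<inter> A \<noteq> {} \<and> outp H e - A \<noteq> {}) \<or> (outp H e \<subseteq> A \<and> A \<subseteq> UNIV - inp H e)}"

definition hyperedge_expansion :: "('v::finite, 'e) oriented_hypergraph \<Rightarrow> real" where
  "hyperedge_expansion H =
     Min {real (card (boundary H A)) / real (min (vol H A) (vol H (UNIV - A))) |A.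
            A \<noteq> {} \<and> A \<noteq> UNIV}"

definition rayleigh :: "('v::finite, 'e) oriented_hypergraph \<Rightarrow> real \<Rightarrow> real ^ 'v \<Rightarrow> real" where
  "rayleigh H p f =
     (\<Sum>e\<in>hyperedges H. \<bar>Max ((\<lambda>u. f $ u) ` inp H e) - Min ((\<lambda>v. f $ v) ` outp H e)\<bar> powr p)
     / (\<Sum>v\<in>UNIV. real (deg H v) * \<bar>f $ v\<bar> powr p)"

text \<open>
  The library's \<open>nsphere n\<close> is the \<open>n\<close>-dimensional sphere, so \<open>\<S>\<^sup>m\<^sup>-\<^sup>1\<close> is \<open>nsphere (m - 1)\<close> for
  \<open>m \<ge> 1\<close>; for \<open>m = 0\<close> it is empty, so that exactly the empty set has genus \<open>0\<close>. The set \<open>Y\<close> is not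
  required to be centrally symmetric: oddness of the map is imposed at those points \<open>x\<close> of \<open>Y\<close>
  whose antipode \<open>-x\<close> also lies in \<open>Y\<close>. This matters since the numerator of the Rayleigh quotient
  need not be an even function of \<open>f\<close>; where it is even, symmetric sets give the same eigenvalues.
\<close>

definition has_odd_sphere_map :: "'a::real_normed_vector set \<Rightarrow> nat \<Rightarrow> bool" where
  "has_odd_sphere_map Y m \<longleftrightarrow>
     (case m of
        0 \<Rightarrow> Y = {}
      | Suc d \<Rightarrow> \<exists>\<zeta>. continuous_map (top_of_set Y) (nsphere d) \<zeta> \<and>
                     (\<forall>x\<in>Y. -x \<in> Y \<longrightarrow> (\<forall>i. \<zeta> x i = - \<zeta> (-x) i)))"

definition genus :: "'a::real_normed_vector set \<Rightarrow> enat" where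
  "genus Y = (INF m\<in>{m. has_odd_sphere_map Y m}. enat m)"

text \<open>
  The Rayleigh quotient is nonnegative, so the infimum and supremum are taken in \<open>[0, \<infinity>]\<close>; the
  eigenvalue is \<open>\<infinity>\<close> if no set of genus at least \<open>k\<close> exists.
\<close>

definition minmax_eigenvalue ::
  "('v::finite, 'e) oriented_hypergraph \<Rightarrow> real \<Rightarrow> nat \<Rightarrow> ennreal" where
  "minmax_eigenvalue H p k =
     (INF Y\<in>{Y. Y \<subseteq> UNIV - {0} \<and> genus Y \<ge> enat k}. SUP f\<in>Y. ennreal (rayleigh H p f))"

definition ennreal_powr :: "ennreal \<Rightarrow> real \<Rightarrow> ennreal" where
  "ennreal_powr x p = (if x = \<infinity> then \<infinity> else ennreal (enn2real x powr p))"

end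

theory Submission
  imports Defs
begin

text \<open>
  The signed power \<open>x \<mapsto> sgn x \<bar>x\<bar>\<^sup>p\<close>, applied to each coordinate, is an odd homeomorphism of
  \<open>\<real>\<^sup>V - {0}\<close>, so it preserves the genus, and being monotone it commutes with the extrema over a
  hyperedge. The comparison of eigenvalues is therefore a pointwise comparison of the Rayleigh
  quotient of order \<open>p\<close> at \<open>f\<close> with that of order \<open>1\<close> at the signed power of \<open>f\<close>. One direction is
  \<open>\<bar>a - b\<bar>\<^sup>p \<le> 2\<^sup>p\<^sup>-\<^sup>1 \<bar>spow p a - spow p b\<bar>\<close>, the other Amghibech's inequality followed by Young's.

  The second eigenvalue of the 1-Laplacian equals \<open>h\<close>: every set of genus at least 2 contains a
  function with median 0, for which the coarea formula bounds the Rayleigh quotient from below by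
  \<open>h\<close>, and a half circle of two-valued functions attains \<open>h\<close>.
\<close>

section \<open>The signed power\<close>

definition spow :: "real \<Rightarrow> real \<Rightarrow> real" where
  "spow p x = sgn x * \<bar>x\<bar> powr p"

lemma spow_nonneg: "0 \<le> x \<Longrightarrow> spow p x = x powr p"
  by (cases "x = 0") (auto simp: spow_def)

lemma spow_minus [simp]: "spow p (- x) = - spow p x"
  by (simp add: spow_def)

lemma spow_zero [simp]: "spow p 0 = 0"
  by (simp add: spow_def)

lemma abs_spow: "\<bar>spow p x\<bar> = \<bar>x\<bar> powr p"
  by (cases "x = 0") (auto simp: spow_def abs_mult abs_sgn_eq)

lemma spow_eq_0_iff [simp]: "spow p x = 0 \<longleftrightarrow> x = 0"
  by (auto simp: spow_def sgn_eq_0_iff)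

lemma spow_one [simp]: "spow 1 x = x"
  by (simp add: spow_def sgn_mult_abs)

lemma spow_spow: "spow p (spow q x) = spow (p * q) x"
proof -
  have *: "spow p (spow q x) = spow (p * q) x" if "0 \<le> x" for x
    using that by (simp add: spow_nonneg powr_powr mult.commute)
  show ?thesis
    using *[of x] *[of "- x"] by (cases "0 \<le> x") auto
qed

lemma mono_spow:
  assumes "0 \<le> p"
  shows "mono (spow p)"
proof
  fix x y :: real
  assume "x \<le> y"
  have *: "spow p x \<le> spow p y" if "0 \<le> x" "x \<le> y" for x y
    using that assms by (simp add: spow_nonneg powr_mono2)
  consider "0 \<le> x" | "y \<le> 0" | "x < 0" "0 < y" by linarith
  then show "spow p x \<le> spow p y"
  proof cases
    case 2
    then show ?thesis using *[of "- y" "- x"] \<open>x \<le> y\<close> by simp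
  next
    case 3
    then have "spow p x \<le> 0" "0 \<le> spow p y" by (simp_all add: spow_def)
    then show ?thesis by linarith
  qed (use * \<open>x \<le> y\<close> in blast)
qed

text \<open>A form free of the discontinuous \<open>sgn\<close>, from which continuity can be read
  off.\<close>

lemma spow_max_min: "0 < p \<Longrightarrow> spow p x = max x 0 powr p - max (- x) 0 powr p"
  by (auto simp: spow_def sgn_if max_def)

lemma continuous_on_spow [continuous_intros]:
  assumes "0 < p" "continuous_on S f"
  shows "continuous_on S (\<lambda>x. spow p (f x))"
  unfolding spow_max_min[OF assms(1)] using assms
  by (intro continuous_intros continuous_on_powr') auto

lemma spow_has_real_derivative:
  assumes "1 < p"
  shows "(spow p has_real_derivative p * \<bar>x\<bar> powr (p - 1)) (at x)"
proof -
  have pos: "(spow p has_real_derivative p * x powr (p - 1)) (at x)" if "0 < x" for x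
  proof (rule has_field_derivative_transform_within_open[of "\<lambda>x. x powr p" _ _ "{0<..}"])
    show "((\<lambda>x. x powr p) has_real_derivative p * x powr (p - 1)) (at x)"
      using that by (auto intro!: derivative_eq_intros)
  qed (use that in \<open>auto simp: spow_nonneg\<close>)
  consider "0 < x" | "x < 0" | "x = 0" by linarith
  then show ?thesis
  proof cases
    case 1
    then show ?thesis using pos by simp
  next
    case 2
    have "((\<lambda>x. - spow p (- x)) has_real_derivative - (p * (- x) powr (p - 1) * - 1)) (at x)"
      using pos[of "- x"] 2
      by (intro DERIV_minus DERIV_chain'[where f = uminus]) (auto intro!: derivative_eq_intros)
    then show ?thesis using 2 by simp
  next
    case 3
    \<comment> \<open>At 0 the difference quotient is \<open>\<bar>h\<bar> powr (p - 1)\<close>,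
      which tends to 0 because 1 < p.\<close>
    have "((\<lambda>h::real. \<bar>h\<bar> powr (p - 1)) \<longlongrightarrow> \<bar>0\<bar> powr (p - 1)) (at 0)"
      using assms by (intro tendsto_powr' tendsto_intros) auto
    moreover have "spow p h / h = \<bar>h\<bar> powr (p - 1)" if "h \<noteq> 0" for h
      using that by (simp add: spow_def powr_diff sgn_if)
    ultimately have "((\<lambda>h. spow p h / h) \<longlongrightarrow> 0) (at 0)"
      by (smt (verit, ccfv_SIG) abs_zero eventually_at_topological filterlim_cong powr_0 tendsto_cong
          eventually_at_filter eventually_mono UNIV_I open_UNIV)
    then show ?thesis using 3 by (simp add: DERIV_def)
  qed
qed

section \<open>Inequalities for powers\<close>

text \<open>Weighted AM-GM for \<open>x powr p\<close> and \<open>y powr p\<close> with weights 1/p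
  and 1 - 1/p. Geometrically, the convex power lies above its tangent at y.\<close>

lemma Young_powr:
  fixes x y p :: real
  assumes "1 \<le> p" "0 \<le> x" "0 \<le> y"
  shows "p * x * y powr (p - 1) \<le> x powr p + (p - 1) * y powr p"
proof (cases "x = 0 \<or> y = 0")
  case True
  then show ?thesis using assms by auto
next
  case False
  then have "(x powr p) powr (1 / p) * (y powr p) powr (1 - 1 / p)
      \<le> (1 / p) * x powr p + (1 - 1 / p) * y powr p"
    using assms by (intro Youngs_inequality_0) auto
  moreover have "p * (1 - 1 / p) = p - 1" using assms by (simp add: field_simps)
  ultimately have "x * y powr (p - 1) \<le> (1 / p) * x powr p + (1 - 1 / p) * y powr p"
    using False assms by (simp add: powr_powr)
  from mult_left_mono[OF this, of p] show ?thesis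
    using assms \<open>p * (1 - 1 / p) = p - 1\<close> by (simp add: algebra_simps)
qed

text \<open>The tangent bounds at the combined point y, evaluated at \<bar>a\<bar> and
  \<bar>b\<bar>, are averaged with weights u and 1 - u.\<close>

lemma abs_powr_convex:
  fixes a b u p :: real
  assumes "1 \<le> p" "0 \<le> u" "u \<le> 1"
  shows "\<bar>(1 - u) * b + u * a\<bar> powr p \<le> (1 - u) * \<bar>b\<bar> powr p + u * \<bar>a\<bar> powr p"
proof -
  define y where "y = \<bar>(1 - u) * b + u * a\<bar>"
  have "0 \<le> y" by (simp add: y_def)
  have "y \<le> (1 - u) * \<bar>b\<bar> + u * \<bar>a\<bar>"
    unfolding y_def using assms by (intro order_trans[OF abs_triangle_ineq]) (simp add: abs_mult)
  then have "p * y powr (p - 1) * y \<le> p * y powr (p - 1) * ((1 - u) * \<bar>b\<bar> + u * \<bar>a\<bar>)"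
    using assms by (intro mult_left_mono) auto
  also have "\<dots> = (1 - u) * (p * \<bar>b\<bar> * y powr (p - 1)) + u * (p * \<bar>a\<bar> * y powr (p - 1))"
    by (simp add: algebra_simps)
  also have "\<dots> \<le> (1 - u) * (\<bar>b\<bar> powr p + (p - 1) * y powr p)
      + u * (\<bar>a\<bar> powr p + (p - 1) * y powr p)"
    using assms \<open>0 \<le> y\<close> by (intro add_mono mult_left_mono Young_powr) auto
  also have "\<dots> = (1 - u) * \<bar>b\<bar> powr p + u * \<bar>a\<bar> powr p + (p - 1) * y powr p"
    by (simp add: algebra_simps)
  finally have "p * (y powr (p - 1) * y) \<le> \<dots>" by (simp add: mult.assoc)
  moreover have "y powr (p - 1) * y = y powr p"
    using \<open>0 \<le> y\<close> by (cases "y = 0") (auto simp: powr_diff)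
  ultimately show ?thesis by (simp add: y_def algebra_simps)
qed

text \<open>For equal signs this follows from superadditivity of the power. The factor
  \<open>2 powr (p - 1)\<close> comes from opposite signs, by convexity at the midpoint of a and
  -b.\<close>

lemma abs_diff_powr_le_spow_diff:
  assumes "1 \<le> p"
  shows "\<bar>a - b\<bar> powr p \<le> 2 powr (p - 1) * \<bar>spow p a - spow p b\<bar>"
proof -
  have super: "(x - y) powr p + y powr p \<le> x powr p" if "0 \<le> y" "y \<le> x" for x y :: real
  proof (cases "x = 0")
    case False
    then have "0 < x" using that by simp
    have u: "u powr p \<le> u" if "0 \<le> u" "u \<le> 1" for u :: real
      using powr_mono'[of 1 p u] that assms by simp
    have "((x - y) / x) powr p + (y / x) powr p \<le> (x - y) / x + y / x"
      using that \<open>0 < x\<close> by (intro add_mono u) auto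
    also have "\<dots> = 1" using \<open>0 < x\<close> by (simp add: field_simps)
    finally show ?thesis
      using that \<open>0 < x\<close> by (simp add: powr_divide add_divide_distrib[symmetric])
  qed (use that in auto)
  have two: "1 \<le> 2 powr (p - 1)" using assms by (simp add: ge_one_powr_ge_zero)
  have same: "\<bar>a - b\<bar> powr p \<le> 2 powr (p - 1) * \<bar>spow p a - spow p b\<bar>"
    if "0 \<le> b" "b \<le> a" for a b
  proof -
    have "(a - b) powr p \<le> a powr p - b powr p" using super[of b a] that by simp
    also have "\<dots> \<le> 2 powr (p - 1) * (a powr p - b powr p)"
      using mult_right_mono[OF two, of "a powr p - b powr p"] that assms
      by (simp add: powr_mono2)
    finally show ?thesis using that assms by (simp add: spow_nonneg powr_mono2)
  qed
  have opp: "\<bar>a - b\<bar> powr p \<le> 2 powr (p - 1) * \<bar>spow p a - spow p b\<bar>"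
    if "b \<le> 0" "0 \<le> a" for a b
  proof -
    have mid: "\<bar>(1 - 1/2) * (- b) + 1/2 * a\<bar> = (a - b) / 2"
      using that by (simp add: field_simps)
    have "\<bar>(1 - 1/2) * (- b) + 1/2 * a\<bar> powr p
        \<le> (1 - 1/2) * \<bar>- b\<bar> powr p + 1/2 * \<bar>a\<bar> powr p"
      using assms by (intro abs_powr_convex) auto
    then have "2 * ((a - b) powr p / 2 powr p) \<le> (- b) powr p + a powr p"
      unfolding mid using that by (simp add: powr_divide)
    moreover have "spow p b = - ((- b) powr p)"
      using that spow_nonneg[of "- b" p] by simp
    ultimately show ?thesis
      using that by (simp add: spow_nonneg powr_diff field_simps)
  qed
  have wlog: "\<bar>a - b\<bar> powr p \<le> 2 powr (p - 1) * \<bar>spow p a - spow p b\<bar>" if "b \<le> a" for a b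
  proof -
    consider "0 \<le> b" | "b \<le> 0" "0 \<le> a" | "a \<le> 0" by linarith
    then show ?thesis
    proof cases
      case 3
      then show ?thesis using same[of "- a" "- b"] that by (simp add: abs_minus_commute)
    qed (use same opp that in auto)
  qed
  show ?thesis
    using wlog[of a b] wlog[of b a] by (cases "b \<le> a") (auto simp: abs_minus_commute)
qed

text \<open>
  Integrating \<open>p M \<bar>t\<bar>\<^sup>p\<^sup>-\<^sup>1 \<le> M\<^sup>p + (p - 1) \<bar>t\<bar>\<^sup>p\<close> from \<open>b\<close> to \<open>a\<close>, with the chord in place of
  the convex function \<open>\<bar>t\<bar>\<^sup>p\<close>, gives \<open>M (spow p a - spow p b) \<le> p (a - b) M\<^sup>p\<close>; the polynomial \<open>Q\<close>
  is the antiderivative of the upper bound.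
\<close>

lemma spow_diff_le:
  fixes p a b M :: real
  assumes "1 < p" "0 \<le> M" "M powr p = (\<bar>a\<bar> powr p + \<bar>b\<bar> powr p) / 2"
  shows "\<bar>spow p a - spow p b\<bar> \<le> p * \<bar>a - b\<bar> * M powr (p - 1)"
  using assms(3)
proof (induction b a rule: linorder_wlog)
  case (sym b a)
  then show ?case by (simp add: abs_minus_commute add.commute)
next
  case (le b a)
  show ?case
  proof (cases "a = b")
    case False
    then have "b < a" using le by simp
    define \<beta> where "\<beta> = \<bar>b\<bar> powr p"
    define \<sigma> where "\<sigma> = (\<bar>a\<bar> powr p - \<bar>b\<bar> powr p) / (a - b)"
    define Q where "Q t = M powr p * t + (p - 1) * (\<beta> * (t - b) + \<sigma> * (t - b)\<^sup>2 / 2)" for t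
    \<comment> \<open>Since a and b differ, they are not both 0; so M is positive and can be
      cancelled at the end.\<close>
    have "0 < \<bar>a\<bar> powr p + \<bar>b\<bar> powr p"
      using \<open>b < a\<close> by (smt (verit) powr_gt_zero zero_less_abs_iff powr_ge_zero)
    then have "0 < M" and Mp: "M powr p = (\<bar>a\<bar> powr p + \<bar>b\<bar> powr p) / 2"
      using le(2) assms(2) by (auto simp: less_le)
    have "M * spow p b - Q b \<ge> M * spow p a - Q a"
    proof (rule DERIV_nonpos_imp_nonincreasing[OF less_imp_le[OF \<open>b < a\<close>]])
      fix t
      assume t: "b \<le> t" "t \<le> a"
      have D: "((\<lambda>t. M * spow p t - Q t) has_real_derivative
          M * (p * \<bar>t\<bar> powr (p - 1)) - (M powr p + (p - 1) * (\<beta> + \<sigma> * (t - b)))) (at t)"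
        unfolding Q_def
        by (rule derivative_eq_intros DERIV_cmult spow_has_real_derivative assms refl | simp)+
      have "\<bar>t\<bar> powr p \<le> \<beta> + \<sigma> * (t - b)"
      proof -
        define u where "u = (t - b) / (a - b)"
        have "u * (a - b) = t - b" using \<open>b < a\<close> by (simp add: u_def)
        then have "t = (1 - u) * b + u * a" by (simp add: algebra_simps)
        moreover have "0 \<le> u" "u \<le> 1" using t \<open>b < a\<close> by (auto simp: u_def)
        ultimately have "\<bar>t\<bar> powr p \<le> (1 - u) * \<bar>b\<bar> powr p + u * \<bar>a\<bar> powr p"
          using abs_powr_convex[of p u b a] assms by simp
        also have "\<dots> = \<beta> + \<sigma> * (t - b)"
          by (simp add: u_def \<beta>_def \<sigma>_def algebra_simps diff_divide_distrib)
        finally show ?thesis .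
      qed
      then have "(p - 1) * \<bar>t\<bar> powr p \<le> (p - 1) * (\<beta> + \<sigma> * (t - b))"
        using assms by (intro mult_left_mono) auto
      moreover have "p * M * \<bar>t\<bar> powr (p - 1) \<le> M powr p + (p - 1) * \<bar>t\<bar> powr p"
        using assms \<open>0 < M\<close> by (intro Young_powr) auto
      ultimately show "\<exists>y. ((\<lambda>t. M * spow p t - Q t) has_real_derivative y) (at t) \<and> y \<le> 0"
        using D by (intro exI conjI) (auto simp: algebra_simps)
    qed
    \<comment> \<open>The chord integrates to the trapezoid area, which is (a - b)
      \<open>M powr p\<close> by the choice of M; the weights 1 and p - 1 add up to p.\<close>
    moreover have "Q a - Q b = (a - b) * (p * M powr p)"
    proof -
      have "\<sigma> * (a - b)\<^sup>2 = (\<bar>a\<bar> powr p - \<bar>b\<bar> powr p) * (a - b)"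
        using \<open>b < a\<close> by (simp add: \<sigma>_def power2_eq_square)
      moreover have "Q a - Q b = M powr p * (a - b) + (p - 1) * (\<beta> * (a - b) + \<sigma> * (a - b)\<^sup>2 / 2)"
        by (simp add: Q_def right_diff_distrib)
      ultimately have "Q a - Q b = M powr p * (a - b)
          + (p - 1) * (\<bar>b\<bar> powr p * (a - b) + (\<bar>a\<bar> powr p - \<bar>b\<bar> powr p) * (a - b) / 2)"
        by (simp only: \<beta>_def)
      then show ?thesis by (simp add: Mp field_simps)
    qed
    ultimately have "M * (spow p a - spow p b) \<le> M * (p * (a - b) * M powr (p - 1))"
      using \<open>0 < M\<close> by (simp add: algebra_simps powr_diff)
    then have "spow p a - spow p b \<le> p * (a - b) * M powr (p - 1)"
      using \<open>0 < M\<close> by simp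
    moreover have "spow p b \<le> spow p a"
      using monoD[OF mono_spow[of p]] assms \<open>b < a\<close> by simp
    ultimately show ?thesis using \<open>b < a\<close> by simp
  qed simp
qed

text \<open>M is the p-th power mean of \<bar>a\<bar> and \<bar>b\<bar>. Young's inequality for s
  \<bar>a - b\<bar> and M turns the product bound into a sum, which can be added up over
  hyperedges.\<close>

lemma spow_diff_le_weighted:
  assumes "1 \<le> p" "0 \<le> s"
  shows "s * \<bar>spow p a - spow p b\<bar>
    \<le> s powr p * \<bar>a - b\<bar> powr p + (p - 1) / 2 * (\<bar>a\<bar> powr p + \<bar>b\<bar> powr p)"
proof (cases "p = 1")
  case True
  then show ?thesis using assms by simp
next
  case False
  define M where "M = ((\<bar>a\<bar> powr p + \<bar>b\<bar> powr p) / 2) powr (1 / p)"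
  have Mp: "M powr p = (\<bar>a\<bar> powr p + \<bar>b\<bar> powr p) / 2"
    using False assms by (simp add: M_def powr_powr)
  have "s * \<bar>spow p a - spow p b\<bar> \<le> s * (p * \<bar>a - b\<bar> * M powr (p - 1))"
    using False assms Mp by (intro mult_left_mono spow_diff_le) (auto simp: M_def)
  also have "\<dots> = p * (s * \<bar>a - b\<bar>) * M powr (p - 1)" by simp
  also have "\<dots> \<le> (s * \<bar>a - b\<bar>) powr p + (p - 1) * M powr p"
    using assms by (intro Young_powr) (auto simp: M_def)
  finally show ?thesis using assms by (simp add: Mp powr_mult)
qed

section \<open>Genus\<close>

text \<open>An odd map on the image is pulled back by composition; antipodal points of Y go to
  antipodal points of the image.\<close>

lemma has_odd_sphere_map_image:
  assumes "continuous_on Y \<phi>" "\<And>x. \<phi> (- x) = - \<phi> x" "has_odd_sphere_map (\<phi> ` Y) m"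
  shows "has_odd_sphere_map Y m"
proof (cases m)
  case 0
  then show ?thesis using assms(3) by (simp add: has_odd_sphere_map_def)
next
  case (Suc d)
  then obtain \<zeta> where \<zeta>: "continuous_map (top_of_set (\<phi> ` Y)) (nsphere d) \<zeta>"
    and odd: "\<And>x i. x \<in> \<phi> ` Y \<Longrightarrow> - x \<in> \<phi> ` Y \<Longrightarrow> \<zeta> x i = - \<zeta> (- x) i"
    using assms(3) by (auto simp: has_odd_sphere_map_def)
  have "continuous_map (top_of_set Y) (top_of_set (\<phi> ` Y)) \<phi>"
    using assms(1) by (auto simp: continuous_map_in_subtopology)
  then have "continuous_map (top_of_set Y) (nsphere d) (\<zeta> \<circ> \<phi>)"
    using \<zeta> by (rule continuous_map_compose)
  moreover have "(\<zeta> \<circ> \<phi>) x i = - (\<zeta> \<circ> \<phi>) (- x) i" if "x \<in> Y" "- x \<in> Y" for x i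
  proof -
    have "\<phi> x \<in> \<phi> ` Y" "- \<phi> x \<in> \<phi> ` Y"
      using that by (simp_all flip: assms(2))
    then show ?thesis unfolding o_def assms(2) by (rule odd)
  qed
  ultimately have "\<exists>\<zeta>. continuous_map (top_of_set Y) (nsphere d) \<zeta> \<and>
      (\<forall>x\<in>Y. -x \<in> Y \<longrightarrow> (\<forall>i. \<zeta> x i = - \<zeta> (-x) i))"
    by (intro exI[of _ "\<zeta> \<circ> \<phi>"] conjI ballI impI allI)
  then show ?thesis by (simp add: has_odd_sphere_map_def Suc)
qed

lemma genus_image_ge:
  assumes "continuous_on Y \<phi>" "\<And>x. \<phi> (- x) = - \<phi> x"
  shows "genus Y \<le> genus (\<phi> ` Y)"
  unfolding genus_def
proof (rule INF_superset_mono)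
  show "{m. has_odd_sphere_map (\<phi> ` Y) m} \<subseteq> {m. has_odd_sphere_map Y m}"
    by (intro Collect_mono impI) (rule has_odd_sphere_map_image[of Y \<phi>, OF assms])
qed (rule order_refl)

text \<open>Genus 0 means empty, so only maps to the 0-sphere remain to be excluded.\<close>

lemma genus_ge_2_iff: "enat 2 \<le> genus Y \<longleftrightarrow> Y \<noteq> {} \<and> \<not> has_odd_sphere_map Y 1"
proof
  assume L: "enat 2 \<le> genus Y"
  have *: "2 \<le> m" if "has_odd_sphere_map Y m" for m
  proof -
    have "genus Y \<le> enat m" unfolding genus_def using that by (intro INF_lower) simp
    with L have "enat 2 \<le> enat m" by (rule order_trans)
    then show ?thesis by simp
  qed
  show "Y \<noteq> {} \<and> \<not> has_odd_sphere_map Y 1"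
    using *[of 0] *[of 1] by (auto simp: has_odd_sphere_map_def)
next
  assume R: "Y \<noteq> {} \<and> \<not> has_odd_sphere_map Y 1"
  have "2 \<le> m" if "has_odd_sphere_map Y m" for m
  proof (rule ccontr)
    assume "\<not> 2 \<le> m"
    then consider "m = 0" | "m = 1" by linarith
    then show False using that R by cases (auto simp: has_odd_sphere_map_def)
  qed
  then show "enat 2 \<le> genus Y" unfolding genus_def by (intro INF_greatest) simp
qed

text \<open>Coordinate 0 of an odd map to the 0-sphere would be continuous, nowhere zero, and of
  opposite signs at x and -x, against the intermediate value theorem.\<close>

lemma genus_ge_2_connected:
  fixes Y :: "'a::real_normed_vector set"
  assumes "connected Y" "x \<in> Y" "- x \<in> Y"
  shows "enat 2 \<le> genus Y"
  unfolding genus_ge_2_iff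
proof (intro conjI notI)
  assume "has_odd_sphere_map Y 1"
  then obtain \<zeta> where \<zeta>: "continuous_map (top_of_set Y) (nsphere 0) \<zeta>"
    and odd: "\<zeta> x 0 = - \<zeta> (- x) 0"
    using assms by (auto simp: has_odd_sphere_map_def)
  have "continuous_map (top_of_set Y) euclideanreal ((\<lambda>z. z 0) \<circ> \<zeta>)"
    using \<zeta> continuous_map_nsphere_projection by (rule continuous_map_compose)
  then have "connected ((\<lambda>y. \<zeta> y 0) ` Y)"
    using assms(1) by (intro connected_continuous_image) (auto simp: o_def)
  moreover have "\<zeta> y 0 \<noteq> 0" if "y \<in> Y" for y
  proof -
    have "\<zeta> y \<in> topspace (nsphere 0)"
      using \<zeta> that continuous_map_image_subset_topspace by fastforce
    then show ?thesis by (auto simp: nsphere)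
  qed
  moreover have "0 \<in> (\<lambda>y. \<zeta> y 0) ` Y" if "connected ((\<lambda>y. \<zeta> y 0) ` Y)"
  proof -
    have "min (\<zeta> x 0) (\<zeta> (- x) 0) \<in> (\<lambda>y. \<zeta> y 0) ` Y"
      "max (\<zeta> x 0) (\<zeta> (- x) 0) \<in> (\<lambda>y. \<zeta> y 0) ` Y"
      using assms by (auto simp: min_def max_def)
    then show ?thesis
      using connectedD_interval[OF that, of "min (\<zeta> x 0) (\<zeta> (- x) 0)" "max (\<zeta> x 0) (\<zeta> (- x) 0)" 0]
        odd by auto
  qed
  ultimately show False by auto
qed (use assms in auto)

lemma has_odd_sphere_map_1I:
  assumes "open U" "open V" "U \<inter> V = {}" "V = uminus ` U" "Y \<subseteq> U \<union> V"
  shows "has_odd_sphere_map Y 1"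
proof -
  define g :: "'a \<Rightarrow> real" where "g x = (if x \<in> U then 1 else - 1)" for x
  have "continuous_on U g \<longleftrightarrow> continuous_on U (\<lambda>_. 1 :: real)"
    "continuous_on V g \<longleftrightarrow> continuous_on V (\<lambda>_. - 1 :: real)"
    using assms(3) by (intro continuous_on_cong; auto simp: g_def)+
  then have "continuous_on (U \<union> V) g"
    using assms by (intro continuous_on_open_Un) auto
  then have cont: "continuous_on Y g"
    using assms(5) continuous_on_subset by blast
  have odd: "g x = - g (- x)" if "x \<in> Y" for x
    using that assms(3-5) by (auto simp: g_def)
  \<comment> \<open>Points of \<open>nsphere 0\<close> are sequences, so the sign g is padded with
    zeros.\<close>
  define \<zeta> :: "'a \<Rightarrow> nat \<Rightarrow> real" where "\<zeta> x i = (if i = 0 then g x else 0)" for x i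
  have "continuous_map (top_of_set Y) (nsphere 0) \<zeta>"
    unfolding nsphere continuous_map_in_subtopology continuous_map_componentwise_UNIV
    using cont by (auto simp: \<zeta>_def g_def)
  then show ?thesis
    unfolding has_odd_sphere_map_def One_nat_def nat.case
  proof (intro exI[of _ \<zeta>] conjI ballI impI allI)
    show "\<zeta> x i = - \<zeta> (- x) i" if "x \<in> Y" for x i
      using odd[OF that] by (simp only: \<zeta>_def) simp
  qed
qed

section \<open>Rayleigh quotients\<close>

text \<open>The layer-cake form of \<bar>a - b\<bar>. The interval is half-open to match strict
  superlevel sets.\<close>

lemma min_max_integral: "((indicator {min a b..<max a b} :: real \<Rightarrow> real) has_integral \<bar>a - b\<bar>) UNIV"
proof -
  have "((\<lambda>_. 1 :: real) has_integral \<bar>a - b\<bar>) {min a b..max a b}"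
    using has_integral_const_real[of "1::real" "min a b" "max a b"] by (auto simp: min_def max_def)
  then have "((indicator {min a b..<max a b} :: real \<Rightarrow> real) has_integral \<bar>a - b\<bar>) {min a b..max a b}"
    by (rule has_integral_spike_finite[of "{max a b}", rotated 2]) (auto simp: indicator_def)
  then show ?thesis
    by (rule has_integral_on_superset) auto
qed

definition vspow :: "real \<Rightarrow> real ^ 'v \<Rightarrow> real ^ 'v::finite" where
  "vspow p f = (\<chi> i. spow p (f $ i))"

lemma vspow_nth [simp]: "vspow p f $ i = spow p (f $ i)"
  by (simp add: vspow_def)

lemma vspow_minus: "vspow p (- f) = - vspow p f"
  by (simp add: vec_eq_iff)

lemma vspow_eq_0_iff [simp]: "vspow p f = 0 \<longleftrightarrow> f = 0"
  by (simp add: vec_eq_iff)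

lemma vspow_vspow: "vspow p (vspow q f) = vspow (p * q) f"
  by (simp add: vec_eq_iff spow_spow)

lemma vspow_one [simp]: "vspow 1 f = f"
  by (simp add: vec_eq_iff)

lemma continuous_on_vspow: "0 < p \<Longrightarrow> continuous_on S (vspow p)"
  unfolding vspow_def by (intro continuous_intros)

locale hypergraph =
  fixes H :: "('v::finite, 'e) oriented_hypergraph"
  assumes finite_hyperedges: "finite (hyperedges H)"
    and inp_nonempty: "e \<in> hyperedges H \<Longrightarrow> inp H e \<noteq> {}"
    and outp_nonempty: "e \<in> hyperedges H \<Longrightarrow> outp H e \<noteq> {}"
    and deg_pos: "0 < deg H v"
begin

abbreviation hi :: "real ^ 'v \<Rightarrow> 'e \<Rightarrow> real" where
  "hi f e \<equiv> Max ((\<lambda>u. f $ u) ` inp H e)"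

abbreviation lo :: "real ^ 'v \<Rightarrow> 'e \<Rightarrow> real" where
  "lo f e \<equiv> Min ((\<lambda>v. f $ v) ` outp H e)"

definition num :: "real \<Rightarrow> real ^ 'v \<Rightarrow> real" where
  "num p f = (\<Sum>e\<in>hyperedges H. \<bar>hi f e - lo f e\<bar> powr p)"

definition den :: "real \<Rightarrow> real ^ 'v \<Rightarrow> real" where
  "den p f = (\<Sum>v\<in>UNIV. real (deg H v) * \<bar>f $ v\<bar> powr p)"

lemma rayleigh_eq: "rayleigh H p f = num p f / den p f"
  by (simp add: rayleigh_def num_def den_def)

lemma num_nonneg: "0 \<le> num p f"
  by (simp add: num_def sum_nonneg)

lemma den_pos:
  assumes "f \<noteq> 0"
  shows "0 < den p f"
proof -
  obtain v where "f $ v \<noteq> 0" using assms by (auto simp: vec_eq_iff)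
  then show ?thesis
    unfolding den_def using deg_pos[of v] by (intro sum_pos2[of _ v]) auto
qed

text \<open>Double counting of incidences: each hyperedge receives one copy of the power at each of
  its vertices, so inequalities can be proved edge by edge.\<close>

lemma den_eq_sum_edges:
  "den p f = (\<Sum>e\<in>hyperedges H. \<Sum>v\<in>inp H e \<union> outp H e. \<bar>f $ v\<bar> powr p)"
proof -
  have "den p f = (\<Sum>v\<in>UNIV. \<Sum>e | e \<in> hyperedges H \<and> v \<in> inp H e \<union> outp H e. \<bar>f $ v\<bar> powr p)"
    by (simp add: den_def deg_def)
  also have "\<dots> = (\<Sum>e\<in>hyperedges H. \<Sum>v | v \<in> UNIV \<and> v \<in> inp H e \<union> outp H e. \<bar>f $ v\<bar> powr p)"
    using finite_hyperedges by (intro sum.swap_restrict) auto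
  finally show ?thesis by (simp add: Un_def)
qed

lemma hi_vspow:
  assumes "0 \<le> p" "e \<in> hyperedges H"
  shows "hi (vspow p f) e = spow p (hi f e)"
  using mono_Max_commute[OF mono_spow[OF assms(1)], of "(\<lambda>u. f $ u) ` inp H e"]
    inp_nonempty[OF assms(2)] by (simp add: image_image)

lemma lo_vspow:
  assumes "0 \<le> p" "e \<in> hyperedges H"
  shows "lo (vspow p f) e = spow p (lo f e)"
  using mono_Min_commute[OF mono_spow[OF assms(1)], of "(\<lambda>u. f $ u) ` outp H e"]
    outp_nonempty[OF assms(2)] by (simp add: image_image)

lemma num_vspow:
  assumes "0 \<le> p"
  shows "num 1 (vspow p f) = (\<Sum>e\<in>hyperedges H. \<bar>spow p (hi f e) - spow p (lo f e)\<bar>)"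
  unfolding num_def
proof (rule sum.cong)
  fix e
  assume "e \<in> hyperedges H"
  then show "\<bar>hi (vspow p f) e - lo (vspow p f) e\<bar> powr 1 = \<bar>spow p (hi f e) - spow p (lo f e)\<bar>"
    using assms hi_vspow lo_vspow by (simp del: vspow_nth)
qed simp

lemma den_vspow: "den 1 (vspow p f) = den p f"
  by (simp add: den_def abs_spow)

section \<open>Pointwise comparison of the Rayleigh quotients of orders p and 1\<close>

lemma rayleigh_le_rayleigh_1:
  assumes "1 \<le> p"
  shows "rayleigh H p f \<le> 2 powr (p - 1) * rayleigh H 1 (vspow p f)"
proof -
  have "num p f \<le> 2 powr (p - 1) * num 1 (vspow p f)"
    using assms
    by (simp add: num_vspow num_def[of p] sum_distrib_left sum_mono abs_diff_powr_le_spow_diff)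
  moreover have "0 \<le> den p f" by (simp add: den_def sum_nonneg)
  ultimately show ?thesis
    by (simp add: rayleigh_eq den_vspow divide_right_mono)
qed

lemma num_1_vspow_le:
  assumes "1 \<le> p" "0 \<le> s"
  shows "s * num 1 (vspow p f) \<le> s powr p * num p f + (p - 1) / 2 * den p f"
proof -
  have "s * \<bar>spow p (hi f e) - spow p (lo f e)\<bar> \<le> s powr p * \<bar>hi f e - lo f e\<bar> powr p
      + (p - 1) / 2 * (\<Sum>v\<in>inp H e \<union> outp H e. \<bar>f $ v\<bar> powr p)"
    if e: "e \<in> hyperedges H" for e
  proof (cases "hi f e = lo f e")
    case True
    then show ?thesis using assms by (simp add: sum_nonneg)
  next
    case False
    have "hi f e \<in> (\<lambda>u. f $ u) ` inp H e" "lo f e \<in> (\<lambda>u. f $ u) ` outp H e"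
      using inp_nonempty[OF e] outp_nonempty[OF e] by (intro Max_in Min_in; simp)+
    then obtain u v where u: "u \<in> inp H e" "hi f e = f $ u" and v: "v \<in> outp H e" "lo f e = f $ v"
      by auto
    \<comment> \<open>As the extrema differ, u and v are distinct, and both powers occur in the sum
      over the vertices of e.\<close>
    have "\<bar>f $ u\<bar> powr p + \<bar>f $ v\<bar> powr p = (\<Sum>v\<in>{u, v}. \<bar>f $ v\<bar> powr p)"
      using False u v by (cases "u = v") auto
    also have "\<dots> \<le> (\<Sum>v\<in>inp H e \<union> outp H e. \<bar>f $ v\<bar> powr p)"
      using u v by (intro sum_mono2) auto
    finally have "(p - 1) / 2 * (\<bar>f $ u\<bar> powr p + \<bar>f $ v\<bar> powr p) \<le> (p - 1) / 2 * \<dots>"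
      using assms by (intro mult_left_mono) auto
    then show ?thesis
      using spow_diff_le_weighted[OF assms, of "f $ u" "f $ v"] u v by simp
  qed
  then show ?thesis
    using assms
    by (simp add: num_vspow num_def[of p] den_eq_sum_edges sum_distrib_left sum_mono
        flip: sum.distrib)
qed

text \<open>The weight \<open>s = p / (2 R\<^sub>1)\<close> makes the weighted inequality as sharp as Hoelder's.\<close>

lemma rayleigh_1_le_rayleigh:
  assumes "1 \<le> p" "f \<noteq> 0"
  shows "2 powr (p - 1) / p powr p * rayleigh H 1 (vspow p f) powr p \<le> rayleigh H p f"
proof (cases "rayleigh H 1 (vspow p f) = 0")
  \<comment> \<open>The weight s would divide by zero here, but the left side vanishes since
    \<open>0 powr p = 0\<close>.\<close>
  case True
  moreover have "0 \<le> rayleigh H p f"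
    using num_nonneg[of p f] den_pos[OF assms(2), of p] by (simp add: rayleigh_eq)
  ultimately show ?thesis by simp
next
  case False
  define r where "r = rayleigh H 1 (vspow p f)"
  define s where "s = p / (2 * r)"
  have D: "0 < den p f" using den_pos assms(2) by blast
  have r: "r = num 1 (vspow p f) / den p f"
    by (simp add: r_def rayleigh_eq den_vspow)
  have "0 \<le> r" using D num_nonneg[of 1] by (simp add: r)
  then have "0 < r" using False by (simp add: r_def)
  have "s * num 1 (vspow p f) \<le> s powr p * num p f + (p - 1) / 2 * den p f"
    using assms \<open>0 < r\<close> by (intro num_1_vspow_le) (auto simp: s_def)
  from divide_right_mono[OF this less_imp_le[OF D]]
  have "s * r \<le> s powr p * rayleigh H p f + (p - 1) / 2"
    using D by (simp add: r rayleigh_eq add_divide_distrib)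
  moreover have "s * r = p / 2" using \<open>0 < r\<close> by (simp add: s_def)
  ultimately have "1 \<le> 2 * s powr p * rayleigh H p f" by (simp add: diff_divide_distrib)
  also have "\<dots> = rayleigh H p f / (2 powr (p - 1) / p powr p * r powr p)"
    using assms \<open>0 < r\<close> by (simp add: s_def powr_divide powr_mult powr_diff)
  finally show ?thesis
    using assms \<open>0 < r\<close> by (simp add: r_def[symmetric] le_divide_eq divide_le_eq)
qed

section \<open>Min-max eigenvalues\<close>

lemma minmax_le_SUP:
  assumes "Y \<subseteq> UNIV - {0}" "enat k \<le> genus Y"
  shows "minmax_eigenvalue H p k \<le> (SUP f\<in>Y. ennreal (rayleigh H p f))"
  unfolding minmax_eigenvalue_def using assms by (intro INF_lower) auto

text \<open>A change of variables: the image of a test set under \<open>vspow q\<close> avoids 0 and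
  has no smaller genus, so it is again a test set.\<close>

lemma minmax_le_SUP_vspow:
  assumes "Y \<subseteq> UNIV - {0}" "enat k \<le> genus Y" "0 < q"
  shows "minmax_eigenvalue H p k \<le> (SUP f\<in>Y. ennreal (rayleigh H p (vspow q f)))"
proof -
  have "genus Y \<le> genus (vspow q ` Y)"
    using assms(3) by (intro genus_image_ge continuous_on_vspow vspow_minus)
  then have "minmax_eigenvalue H p k \<le> (SUP f\<in>vspow q ` Y. ennreal (rayleigh H p f))"
    using assms by (intro minmax_le_SUP) auto
  then show ?thesis by (simp add: image_image)
qed

text \<open>Test sets for order 1 are moved by \<open>vspow (1 / p)\<close>, which
  \<open>vspow p\<close> undoes. Dividing by c first leaves a lower bound for an infimum to
  prove.\<close>

lemma minmax_upper:
  assumes "1 \<le> p"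
  shows "minmax_eigenvalue H p k \<le> ennreal (2 powr (p - 1)) * minmax_eigenvalue H 1 k"
proof -
  define c where "c = ennreal (2 powr (p - 1))"
  have "minmax_eigenvalue H p k / c \<le> minmax_eigenvalue H 1 k"
    unfolding minmax_eigenvalue_def[of H 1]
  proof (rule INF_greatest)
    fix Y :: "(real ^ 'v) set"
    assume "Y \<in> {Y. Y \<subseteq> UNIV - {0} \<and> enat k \<le> genus Y}"
    then have "minmax_eigenvalue H p k \<le> (SUP f\<in>Y. ennreal (rayleigh H p (vspow (1 / p) f)))"
      using assms by (intro minmax_le_SUP_vspow) auto
    also have "\<dots> \<le> (SUP f\<in>Y. c * ennreal (rayleigh H 1 f))"
    proof (rule SUP_mono')
      fix f
      have "rayleigh H p (vspow (1 / p) f) \<le> 2 powr (p - 1) * rayleigh H 1 f"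
        using rayleigh_le_rayleigh_1[OF assms, of "vspow (1 / p) f"] assms
        by (simp add: vspow_vspow)
      then show "ennreal (rayleigh H p (vspow (1 / p) f)) \<le> c * ennreal (rayleigh H 1 f)"
        by (simp add: c_def ennreal_leI flip: ennreal_mult')
    qed
    also have "\<dots> = c * (SUP f\<in>Y. ennreal (rayleigh H 1 f))"
      by (simp add: SUP_mult_left_ennreal)
    finally show "minmax_eigenvalue H p k / c \<le> (SUP f\<in>Y. ennreal (rayleigh H 1 f))"
      by (simp add: c_def divide_le_posI_ennreal mult.commute)
  qed
  then have "c * (minmax_eigenvalue H p k / c) \<le> c * minmax_eigenvalue H 1 k"
    by (rule mult_left_mono) simp
  then show ?thesis
    by (simp add: c_def ennreal_times_divide mult.commute ennreal_mult_divide_eq)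
qed

lemma minmax_lower:
  assumes "1 \<le> p"
  shows "ennreal (2 powr (p - 1) / p powr p) * ennreal_powr (minmax_eigenvalue H 1 k) p
    \<le> minmax_eigenvalue H p k"
  unfolding minmax_eigenvalue_def[of H p]
proof (rule INF_greatest)
  fix Y :: "(real ^ 'v) set"
  assume "Y \<in> {Y. Y \<subseteq> UNIV - {0} \<and> enat k \<le> genus Y}"
  then have Y: "Y \<subseteq> UNIV - {0}" and
    le: "minmax_eigenvalue H 1 k \<le> (SUP f\<in>Y. ennreal (rayleigh H 1 (vspow p f)))"
    using assms by (auto intro!: minmax_le_SUP_vspow)
  define c where "c = 2 powr (p - 1) / p powr p"
  have "0 < c" using assms by (simp add: c_def)
  show "ennreal (2 powr (p - 1) / p powr p) * ennreal_powr (minmax_eigenvalue H 1 k) p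
    \<le> (SUP f\<in>Y. ennreal (rayleigh H p f))"
  proof (cases "SUP f\<in>Y. ennreal (rayleigh H p f)")
    case (real s)
    \<comment> \<open>Taking the p-th root in the pointwise comparison bounds all order 1 quotients
      by one real number.\<close>
    have bound: "rayleigh H 1 (vspow p f) \<le> (s / c) powr (1 / p)" if "f \<in> Y" for f
    proof -
      have "ennreal (rayleigh H p f) \<le> ennreal s"
        unfolding real(2)[symmetric] using that by (rule SUP_upper)
      then have "rayleigh H p f \<le> s" using real(1) by (simp add: ennreal_le_iff)
      moreover have "c * rayleigh H 1 (vspow p f) powr p \<le> rayleigh H p f"
        unfolding c_def using that Y assms by (intro rayleigh_1_le_rayleigh) auto
      ultimately have "rayleigh H 1 (vspow p f) powr p \<le> s / c"
        using \<open>0 < c\<close> by (simp add: field_simps)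
      then have "(rayleigh H 1 (vspow p f) powr p) powr (1 / p) \<le> (s / c) powr (1 / p)"
        using assms by (intro powr_mono2) auto
      then show ?thesis
        using assms num_nonneg[of 1] by (simp add: powr_powr rayleigh_eq den_def sum_nonneg)
    qed
    have "minmax_eigenvalue H 1 k \<le> ennreal ((s / c) powr (1 / p))"
      by (rule order_trans[OF le]) (auto intro!: SUP_least ennreal_leI bound)
    \<comment> \<open>Below a real bound the eigenvalue is finite, so \<open>ennreal_powr\<close>
      takes its real branch.\<close>
    moreover from this obtain l where l: "minmax_eigenvalue H 1 k = ennreal l" "0 \<le> l"
      by (cases "minmax_eigenvalue H 1 k") (auto simp: top_unique)
    ultimately have "l \<le> (s / c) powr (1 / p)" by (simp add: ennreal_le_iff)
    then have "l powr p \<le> ((s / c) powr (1 / p)) powr p"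
      using assms l by (intro powr_mono2) auto
    then have "c * l powr p \<le> s"
      using assms \<open>0 < c\<close> real(1) by (simp add: powr_powr field_simps)
    then show ?thesis
      using l \<open>0 < c\<close> unfolding real(2) c_def[symmetric]
      by (simp add: ennreal_powr_def ennreal_leI flip: ennreal_mult)
  next
    case top
    then show ?thesis by (simp only: top_greatest)
  qed
qed

section \<open>The second eigenvalue of the 1-Laplacian\<close>

lemma vol_mono: "A \<subseteq> B \<Longrightarrow> vol H A \<le> vol H B"
  unfolding vol_def by (intro sum_mono2) auto

lemma vol_pos: "A \<noteq> {} \<Longrightarrow> 0 < vol H A"
  unfolding vol_def using deg_pos by (intro sum_pos) auto

text \<open>With the denominator cleared, the trivial sets are covered as well, as their smaller
  volume is 0; so every superlevel set can be inserted.\<close>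

lemma expansion_mult_le:
  "hyperedge_expansion H * real (min (vol H A) (vol H (UNIV - A))) \<le> real (card (boundary H A))"
proof (cases "A = {} \<or> A = UNIV")
  case True
  then show ?thesis by (auto simp: vol_def)
next
  case False
  have "finite {real (card (boundary H A)) / real (min (vol H A) (vol H (UNIV - A))) |A.
      A \<noteq> {} \<and> A \<noteq> UNIV}"
    by simp
  then have "hyperedge_expansion H \<le> real (card (boundary H A)) / real (min (vol H A) (vol H (UNIV - A)))"
    unfolding hyperedge_expansion_def using False by (intro Min_le) auto
  moreover have "0 < vol H A" "0 < vol H (UNIV - A)"
    using False by (auto intro!: vol_pos)
  ultimately show ?thesis by (simp add: field_simps)
qed

text \<open>
  The coarea formula: a level \<open>t\<close> separates the two extrema over \<open>e\<close> precisely when \<open>e\<close> lies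
  in the boundary of \<open>{f > t}\<close>.
\<close>

lemma card_boundary_superlevel:
  "real (card (boundary H {v. t < f $ v}))
    = (\<Sum>e\<in>hyperedges H. indicator {min (hi f e) (lo f e)..<max (hi f e) (lo f e)} t)"
proof -
  have "boundary H {v. t < f $ v}
      = {e \<in> hyperedges H. t \<in> {min (hi f e) (lo f e)..<max (hi f e) (lo f e)}}" (is "?L = ?R")
  proof -
    have "e \<in> boundary H {v. t < f $ v} \<longleftrightarrow> t \<in> {min (hi f e) (lo f e)..<max (hi f e) (lo f e)}"
      if e: "e \<in> hyperedges H" for e
    proof -
      have "inp H e \<inter> {v. t < f $ v} \<noteq> {} \<longleftrightarrow> t < hi f e"
        using inp_nonempty[OF e] by (subst Max_gr_iff) auto
      moreover have "outp H e - {v. t < f $ v} \<noteq> {} \<longleftrightarrow> lo f e \<le> t"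
        using outp_nonempty[OF e] by (subst Min_le_iff) (auto simp: not_less)
      ultimately have "e \<in> boundary H {v. t < f $ v}
          \<longleftrightarrow> (t < hi f e \<and> lo f e \<le> t) \<or> (t < lo f e \<and> hi f e \<le> t)"
        using e by (auto simp: boundary_def not_le not_less)
      then show ?thesis by auto
    qed
    moreover have "?L \<subseteq> hyperedges H" by (auto simp: boundary_def)
    ultimately show ?thesis by blast
  qed
  then show ?thesis
    using finite_hyperedges by (simp add: indicator_def Int_def flip: sum.inter_filter)
qed

text \<open>The volume assumptions say that 0 is a median of f. At each level t the side away from 0
  then has the smaller volume, and integrating the expansion inequality over t yields
  \<open>num\<close> and \<open>den\<close>.\<close>

lemma expansion_le_rayleigh_1:
  assumes "2 * vol H {v. 0 < f $ v} \<le> vol H UNIV" "2 * vol H {v. f $ v < 0} \<le> vol H UNIV"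
    and "f \<noteq> 0"
  shows "hyperedge_expansion H \<le> rayleigh H 1 f"
proof -
  let ?h = "hyperedge_expansion H"
  have vol_compl: "vol H UNIV = vol H A + vol H (UNIV - A)" for A
    unfolding vol_def by (subst sum.subset_diff[of A UNIV]) auto
  have "?h * (\<Sum>v\<in>UNIV. real (deg H v) * indicator {min (f $ v) 0..<max (f $ v) 0} t)
      \<le> (\<Sum>e\<in>hyperedges H. indicator {min (hi f e) (lo f e)..<max (hi f e) (lo f e)} t)" for t
  proof -
    define A where "A = {v. t < f $ v}"
    have "(\<Sum>v\<in>UNIV. real (deg H v) * indicator {min (f $ v) 0..<max (f $ v) 0} t)
        = real (min (vol H A) (vol H (UNIV - A)))"
    proof (cases "0 \<le> t")
      \<comment> \<open>For t \<ge> 0 the interval between 0 and f(v) contains t exactly when v is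
        in A; for t < 0, exactly when v is outside A.\<close>
      case True
      then have "(\<Sum>v\<in>UNIV. real (deg H v) * indicator {min (f $ v) 0..<max (f $ v) 0} t)
          = (\<Sum>v\<in>UNIV. if v \<in> A then real (deg H v) else 0)"
        by (intro sum.cong) (auto simp: A_def indicator_def)
      moreover have "vol H A \<le> vol H {v. 0 < f $ v}"
        using True by (intro vol_mono) (auto simp: A_def)
      then have "vol H A \<le> vol H (UNIV - A)"
        using assms(1) vol_compl[of A] by linarith
      ultimately show ?thesis by (simp add: sum.If_cases vol_def)
    next
      case False
      then have "(\<Sum>v\<in>UNIV. real (deg H v) * indicator {min (f $ v) 0..<max (f $ v) 0} t)
          = (\<Sum>v\<in>UNIV. if v \<in> UNIV - A then real (deg H v) else 0)"
        by (intro sum.cong) (auto simp: A_def indicator_def)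
      moreover have "vol H (UNIV - A) \<le> vol H {v. f $ v < 0}"
        using False by (intro vol_mono) (auto simp: A_def)
      then have "vol H (UNIV - A) \<le> vol H A"
        using assms(2) vol_compl[of A] by linarith
      ultimately show ?thesis by (simp add: sum.If_cases vol_def set_diff_eq)
    qed
    then show ?thesis
      using expansion_mult_le[of A] by (simp add: A_def card_boundary_superlevel)
  qed
  moreover have "((\<lambda>t. ?h * (\<Sum>v\<in>UNIV. real (deg H v) * indicator {min (f $ v) 0..<max (f $ v) 0} t))
      has_integral ?h * (\<Sum>v\<in>UNIV. real (deg H v) * \<bar>f $ v - 0\<bar>)) UNIV"
    by (intro has_integral_mult_right has_integral_sum min_max_integral) auto
  moreover have "((\<lambda>t. \<Sum>e\<in>hyperedges H. indicator {min (hi f e) (lo f e)..<max (hi f e) (lo f e)} t)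
      has_integral (\<Sum>e\<in>hyperedges H. \<bar>hi f e - lo f e\<bar>)) UNIV"
    by (intro has_integral_sum min_max_integral finite_hyperedges)
  ultimately have "?h * den 1 f \<le> num 1 f"
    by (auto simp: den_def num_def dest: has_integral_le)
  then show ?thesis
    using den_pos[OF assms(3), of 1] by (simp add: rayleigh_eq field_simps)
qed

text \<open>
  A set of genus at least 2 contains a function with median 0: otherwise the sign of the median
  would be an odd map to the 0-sphere.
\<close>

lemma expansion_le_minmax_1: "ennreal (hyperedge_expansion H) \<le> minmax_eigenvalue H 1 2"
  unfolding minmax_eigenvalue_def
proof (rule INF_greatest)
  fix Y :: "(real ^ 'v) set"
  assume "Y \<in> {Y. Y \<subseteq> UNIV - {0} \<and> enat 2 \<le> genus Y}"
  then have Y: "0 \<notin> Y" "\<not> has_odd_sphere_map Y 1"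
    by (auto simp: genus_ge_2_iff)
  \<comment> \<open>U and V collect the functions whose median is strictly positive or strictly
    negative with respect to volume.\<close>
  define U where "U = {f :: real ^ 'v. vol H UNIV < 2 * vol H {v. 0 < f $ v}}"
  define V where "V = {f :: real ^ 'v. vol H UNIV < 2 * vol H {v. f $ v < 0}}"
  \<comment> \<open>This displays U as a finite union of finite intersections of open
    half-spaces.\<close>
  have "U = (\<Union>A\<in>{A. vol H UNIV < 2 * vol H A}. \<Inter>v\<in>A. {f. 0 < f $ v})" (is "_ = ?W")
  proof
    show "?W \<subseteq> U"
    proof
      fix f
      assume "f \<in> ?W"
      then obtain A where "vol H UNIV < 2 * vol H A" "A \<subseteq> {v. 0 < f $ v}" by auto
      then show "f \<in> U" using vol_mono[of A "{v. 0 < f $ v}"] by (simp add: U_def)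
    qed
  qed (auto simp: U_def)
  moreover have "open ?W"
    by (intro open_UN ballI open_INT open_Collect_less continuous_intros) auto
  ultimately have "open U" by simp
  have VU: "V = uminus ` U"
  proof
    show "V \<subseteq> uminus ` U"
    proof
      fix f
      assume "f \<in> V"
      then have "- f \<in> U" by (simp add: U_def V_def)
      then show "f \<in> uminus ` U" by (rule image_eqI[rotated]) simp
    qed
  qed (auto simp: U_def V_def)
  have "open V" unfolding VU using \<open>open U\<close> by (rule open_negations)
  have "U \<inter> V = {}"
  proof -
    have False if "f \<in> U" "f \<in> V" for f
    proof -
      have "vol H {v. 0 < f $ v} + vol H {v. f $ v < 0} = vol H ({v. 0 < f $ v} \<union> {v. f $ v < 0})"
        unfolding vol_def by (intro sum.union_disjoint[symmetric]) auto
      also have "\<dots> \<le> vol H UNIV" by (intro vol_mono) auto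
      finally show False using that by (simp add: U_def V_def)
    qed
    then show ?thesis by auto
  qed
  then obtain f where "f \<in> Y" "f \<notin> U" "f \<notin> V"
    using has_odd_sphere_map_1I[OF \<open>open U\<close> \<open>open V\<close> _ VU] Y(2) by blast
  then have "hyperedge_expansion H \<le> rayleigh H 1 f"
    using Y(1) by (intro expansion_le_rayleigh_1) (auto simp: U_def V_def)
  then show "ennreal (hyperedge_expansion H) \<le> (SUP f\<in>Y. ennreal (rayleigh H 1 f))"
    using \<open>f \<in> Y\<close> by (intro SUP_upper2[of f]) (auto intro: ennreal_leI)
qed

section \<open>Upper bound by h: two-valued functions\<close>

lemma num_step:
  assumes "b \<le> a"
  shows "num 1 (\<chi> v. if v \<in> A then a else b) = (a - b) * real (card (boundary H A))"
proof -
  let ?f = "\<chi> v. if v \<in> A then a else b"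
  have edge: "\<bar>hi ?f e - lo ?f e\<bar> = (if e \<in> boundary H A then a - b else 0)" if e: "e \<in> hyperedges H" for e
  proof -
    \<comment> \<open>The extrema differ in two ways, (a, b) or (b, a), and these are the two
      alternatives in the definition of the boundary.\<close>
    have "hi ?f e = (if inp H e \<inter> A \<noteq> {} then a else b)"
      using inp_nonempty[OF e] assms by (auto intro!: Max_eqI)
    moreover have "lo ?f e = (if outp H e - A \<noteq> {} then b else a)"
      using outp_nonempty[OF e] assms by (auto intro!: Min_eqI)
    ultimately show ?thesis
      using e assms by (auto simp: boundary_def)
  qed
  have "num 1 ?f = (\<Sum>e\<in>hyperedges H. if e \<in> boundary H A then a - b else 0)"
    unfolding num_def
  proof (rule sum.cong)
    fix e
    assume "e \<in> hyperedges H"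
    then show "\<bar>hi ?f e - lo ?f e\<bar> powr 1 = (if e \<in> boundary H A then a - b else 0)"
      unfolding edge[OF \<open>e \<in> hyperedges H\<close>] using assms by simp
  qed simp
  also have "\<dots> = (a - b) * real (card (hyperedges H \<inter> boundary H A))"
    using finite_hyperedges by (simp add: sum.If_cases mult.commute)
  also have "hyperedges H \<inter> boundary H A = boundary H A" by (auto simp: boundary_def)
  finally show ?thesis .
qed

text \<open>Both volumes are at least their minimum and a - b \<le> \<bar>a\<bar> + \<bar>b\<bar>,
  so the factor a - b of the numerator cancels.\<close>

lemma rayleigh_step_le:
  assumes "A \<noteq> {}" "A \<noteq> UNIV" "b \<le> a"
  shows "rayleigh H 1 (\<chi> v. if v \<in> A then a else b)
    \<le> real (card (boundary H A)) / real (min (vol H A) (vol H (UNIV - A)))"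
proof -
  let ?f = "\<chi> v. if v \<in> A then a else b"
  let ?m = "real (min (vol H A) (vol H (UNIV - A)))"
  have "UNIV - A \<noteq> {}" using assms by blast
  then have m: "0 < ?m" using assms by (simp add: vol_pos)
  have "den 1 ?f = (\<Sum>v\<in>UNIV. if v \<in> A then real (deg H v) * \<bar>a\<bar> else real (deg H v) * \<bar>b\<bar>)"
    unfolding den_def by (intro sum.cong) auto
  also have "\<dots> = real (vol H A) * \<bar>a\<bar> + real (vol H (UNIV - A)) * \<bar>b\<bar>"
    by (simp add: sum.If_cases vol_def Compl_eq_Diff_UNIV sum_distrib_right)
  finally have D: "den 1 ?f = \<dots>" .
  have "?m * (a - b) \<le> ?m * \<bar>a\<bar> + ?m * \<bar>b\<bar>"
    using m by (simp flip: distrib_left)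
  also have "\<dots> \<le> den 1 ?f"
    unfolding D by (intro add_mono mult_right_mono) auto
  finally have le: "?m * (a - b) \<le> den 1 ?f" .
  show ?thesis
  proof (cases "a = b")
    case True
    then show ?thesis using num_step[OF assms(3), of A] by (simp add: rayleigh_eq)
  next
    case False
    then have "0 < ?m * (a - b)" using assms m by simp
    then have "0 < den 1 ?f" using le by linarith
    have "num 1 ?f / den 1 ?f \<le> num 1 ?f / (?m * (a - b))"
      using le \<open>0 < ?m * (a - b)\<close> num_nonneg by (intro divide_left_mono) auto
    also have "\<dots> = real (card (boundary H A)) / ?m"
      using False num_step[OF assms(3), of A] by simp
    finally show ?thesis by (simp add: rayleigh_eq)
  qed
qed

text \<open>
  Since \<open>\<partial>A\<close> and \<open>\<partial>(V - A)\<close> may differ in size, the test set is the half circle of functions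
  \<open>a 1\<^sub>A + b 1\<^sub>V\<^sub>-\<^sub>A\<close> with \<open>a \<ge> b\<close> only. It joins the constants \<open>1\<close> and \<open>-1\<close>, so its genus is at
  least 2.
\<close>

lemma minmax_1_le_boundary:
  assumes "A \<noteq> {}" "A \<noteq> UNIV"
  shows "minmax_eigenvalue H 1 2
    \<le> ennreal (real (card (boundary H A)) / real (min (vol H A) (vol H (UNIV - A))))"
proof -
  \<comment> \<open>For t from -2 to 0 the value on A is 1 while the value off A falls from 1 to -1;
    from 0 to 2 the latter stays -1 and the former falls to -1. One of the values always has modulus
    1, so the path avoids 0.\<close>
  define \<gamma> :: "real \<Rightarrow> real ^ 'v"
    where "\<gamma> t = (\<chi> v. if v \<in> A then min 1 (1 - t) else max (- 1) (- 1 - t))" for t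
  define Y where "Y = \<gamma> ` {-2..2}"
  have "continuous_on {-2..2} \<gamma>"
    unfolding \<gamma>_def
  proof (rule continuous_on_vec_lambda)
    show "continuous_on {-2..2::real} (\<lambda>t. if v \<in> A then min 1 (1 - t) else max (- 1) (- 1 - t))" for v :: 'v
      by (cases "v \<in> A") (auto intro!: continuous_intros)
  qed
  then have "connected Y" unfolding Y_def by (intro connected_continuous_image) auto
  moreover have "\<gamma> 2 = - \<gamma> (-2)" by (auto simp: \<gamma>_def vec_eq_iff)
  then have "- \<gamma> (-2) \<in> Y" unfolding Y_def by (auto intro!: image_eqI[of _ \<gamma> 2])
  moreover have "\<gamma> (-2) \<in> Y" unfolding Y_def by auto
  ultimately have "enat 2 \<le> genus Y" using genus_ge_2_connected by blast
  moreover have "\<gamma> t \<noteq> 0" for t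
  proof -
    obtain v w where "v \<in> A" "w \<notin> A" using assms by auto
    then show ?thesis by (auto simp: \<gamma>_def vec_eq_iff min_def max_def intro: exI[of _ v] exI[of _ w])
  qed
  then have "Y \<subseteq> UNIV - {0}" by (auto simp: Y_def)
  ultimately have "minmax_eigenvalue H 1 2 \<le> (SUP f\<in>Y. ennreal (rayleigh H 1 f))"
    by (intro minmax_le_SUP)
  also have "\<dots> \<le> ennreal (real (card (boundary H A)) / real (min (vol H A) (vol H (UNIV - A))))"
  proof (rule SUP_least)
    fix f
    assume "f \<in> Y"
    then obtain t where "f = \<gamma> t" "-2 \<le> t" "t \<le> 2" by (auto simp: Y_def)
    then show "ennreal (rayleigh H 1 f)
        \<le> ennreal (real (card (boundary H A)) / real (min (vol H A) (vol H (UNIV - A))))"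
      unfolding \<gamma>_def using assms by (auto intro!: ennreal_leI rayleigh_step_le)
  qed
  finally show ?thesis .
qed

lemma minmax_1_eq_expansion:
  assumes "2 \<le> CARD('v)"
  shows "minmax_eigenvalue H 1 2 = ennreal (hyperedge_expansion H)" "0 \<le> hyperedge_expansion H"
proof -
  let ?q = "\<lambda>A. real (card (boundary H A)) / real (min (vol H A) (vol H (UNIV - A)))"
  obtain v :: 'v where True by blast
  have "{v} \<noteq> UNIV"
  proof
    assume "{v} = UNIV"
    then have "card {v} = CARD('v)" by (rule arg_cong)
    then show False using assms by simp
  qed
  \<comment> \<open>A singleton is a proper nonempty subset, so the minimum defining h is attained
    at some A.\<close>
  then have "?q {v} \<in> {?q A |A. A \<noteq> {} \<and> A \<noteq> UNIV}" by blast
  then have "{?q A |A. A \<noteq> {} \<and> A \<noteq> UNIV} \<noteq> {}" by blast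
  then have "hyperedge_expansion H \<in> {?q A |A. A \<noteq> {} \<and> A \<noteq> UNIV}"
    unfolding hyperedge_expansion_def by (intro Min_in) auto
  then obtain A where A: "A \<noteq> {}" "A \<noteq> UNIV" "hyperedge_expansion H = ?q A" by blast
  then show "0 \<le> hyperedge_expansion H" by simp
  show "minmax_eigenvalue H 1 2 = ennreal (hyperedge_expansion H)"
    using minmax_1_le_boundary[OF A(1,2)] expansion_le_minmax_1 unfolding A(3) by (rule antisym)
qed

end

theorem theorem5p14:
  fixes H :: "('v::finite, 'e) oriented_hypergraph" and p :: real
  assumes "finite (hyperedges H)"
    and "\<And>e. e \<in> hyperedges H \<Longrightarrow> inp H e \<noteq> {} \<and> outp H e \<noteq> {}"
    and "\<And>e. e \<in> hyperedges H \<Longrightarrow> card (inp H e \<union> outp H e) \<ge> 2"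
    and "\<And>v. deg H v > 0"
    and "p \<ge> 1"
  shows "(\<forall>k\<ge>1.
           ennreal (2 powr (p - 1) / p powr p) * ennreal_powr (minmax_eigenvalue H 1 k) p
             \<le> minmax_eigenvalue H p k \<and>
           minmax_eigenvalue H p k \<le> ennreal (2 powr (p - 1)) * minmax_eigenvalue H 1 k) \<and>
         ennreal (2 powr (p - 1) * (hyperedge_expansion H powr p / p powr p))
           \<le> minmax_eigenvalue H p 2 \<and>
         minmax_eigenvalue H p 2 \<le> ennreal (2 powr (p - 1) * hyperedge_expansion H)"
proof -
  interpret hypergraph H
    using assms by unfold_locales auto
  \<comment> \<open>Some vertex, here \<open>undefined\<close>, has positive degree; hence a
    hyperedge exists, and it forces at least two vertices.\<close>
  have "{e \<in> hyperedges H. undefined \<in> inp H e \<union> outp H e} \<noteq> {}"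
    using assms(4)[of undefined] by (auto simp: deg_def card_gt_0_iff)
  then obtain e where "e \<in> hyperedges H" by blast
  then have "2 \<le> card (inp H e \<union> outp H e)" by (rule assms(3))
  also have "\<dots> \<le> CARD('v)" by (intro card_mono) auto
  finally have card: "2 \<le> CARD('v)" .
  note bounds = minmax_lower[OF assms(5)] minmax_upper[OF assms(5)]
  have "ennreal (2 powr (p - 1) * (hyperedge_expansion H powr p / p powr p)) \<le> minmax_eigenvalue H p 2"
    using bounds(1)[of 2] minmax_1_eq_expansion[OF card]
    by (simp add: ennreal_powr_def flip: ennreal_mult)
  moreover have "minmax_eigenvalue H p 2 \<le> ennreal (2 powr (p - 1) * hyperedge_expansion H)"
    using bounds(2)[of 2] minmax_1_eq_expansion[OF card] by (simp flip: ennreal_mult)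
  ultimately show ?thesis using bounds by blast
qed

end
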